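(* Let $S_1=\{n\in\mathbb{Z} : n\ge 230\}$ and $$S_2=\{91,94,95\}\cup\{119,\dots,124\}\cup\{131,136\}\cup\{152,\dots,170\}\cup\{172,178,181,184,185\}\cup\{189,\dots,223\}.$$ For every $n\in S_1\cup S_2$, the Fibonacci-run graph $\mathcal{R}_n$ satisfies $$\operatorname{diam}(\mathcal{R}_n)>n-\left\lfloor\sqrt{1+\tfrac{n}{2}}-\tfrac34\right\rfloor .$$
   Context: A binary string is run-constrained if every maximal run of 1s in it is immediately followed by a maximal run of 0s of strictly greater length. For $n\ge 0$, the Fibonacci-run graph $\mathcal{R}_n$ has as vertices all binary strings $r$ of length $n$ such that $r00$ (the string $r$ followed by two 0s) is run-constrained; two vertices are adjacent if they differ in exactly one coordinate. $\operatorname{diam}(G)$ denotes the maximum graph distance between two vertices of the connected graph $G$. *)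

theory Defs
  imports Complex_Main "Graph_Theory.Graph_Theory"
begin

text \<open>
  Binary strings are boolean lists, \<open>True\<close> standing for 1 and \<open>False\<close> for 0.
  A run is given by its half-open interval of positions \<open>i \<le> p < j\<close>.
\<close>

definition maximal_run :: "bool \<Rightarrow> bool list \<Rightarrow> nat \<Rightarrow> nat \<Rightarrow> bool" where
  "maximal_run b s i j \<longleftrightarrow>
     i < j \<and> j \<le> length s \<and> (\<forall>p. i \<le> p \<and> p < j \<longrightarrow> s ! p = b) \<and>
     (i = 0 \<or> s ! (i - 1) \<noteq> b) \<and> (j = length s \<or> s ! j \<noteq> b)"

definition run_constrained :: "bool list \<Rightarrow> bool" where
  "run_constrained s \<longleftrightarrow>
     (\<forall>i j. maximal_run True s i j \<longrightarrow> (\<exists>k. maximal_run False s j k \<and> k - j > j - i))"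

definition fib_run_verts :: "nat \<Rightarrow> bool list set" where
  "fib_run_verts n = {r. length r = n \<and> run_constrained (r @ [False, False])}"

text \<open>Each undirected edge is represented by its two opposite arcs.\<close>

definition fib_run_graph :: "nat \<Rightarrow> bool list pair_pre_digraph" where
  "fib_run_graph n =
     \<lparr> pverts = fib_run_verts n,
       parcs = {(u, v). u \<in> fib_run_verts n \<and> v \<in> fib_run_verts n \<and>
                        card {i. i < n \<and> u ! i \<noteq> v ! i} = 1} \<rparr>"

text \<open>
  With unit weights \<open>wf_digraph.\<mu>\<close> is the length of a shortest walk. It is infinite between
  different components, but the graphs \<open>fib_run_graph n\<close> are finite and connected (see below),
  so for them the supremum is a finite maximum.
\<close>

definition graph_dist :: "('a, 'b) pre_digraph \<Rightarrow> 'a \<Rightarrow> 'a \<Rightarrow> ereal" where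
  "graph_dist G u v = wf_digraph.\<mu> G (\<lambda>_. 1) u v"

definition diam :: "('a, 'b) pre_digraph \<Rightarrow> ereal" where
  "diam G = (SUP u \<in> verts G. SUP v \<in> verts G. graph_dist G u v)"

lemma finite_fib_run_verts: "finite (fib_run_verts n)"
proof (rule finite_subset)
  show "fib_run_verts n \<subseteq> {r. set r \<subseteq> UNIV \<and> length r = n}"
    by (auto simp: fib_run_verts_def)
  show "finite {r::bool list. set r \<subseteq> UNIV \<and> length r = n}"
    by (rule finite_lists_length_eq) simp
qed

lemma pair_graph_fib_run_graph: "pair_graph (fib_run_graph n)"
proof
  show "finite (parcs (fib_run_graph n))"
    by (rule finite_subset[of _ "fib_run_verts n \<times> fib_run_verts n"])
       (auto simp: fib_run_graph_def finite_fib_run_verts)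
  have "sym (parcs (fib_run_graph n))"
  proof (rule symI)
    fix u v assume "(u, v) \<in> parcs (fib_run_graph n)"
    moreover have "{i. i < n \<and> u ! i \<noteq> v ! i} = {i. i < n \<and> v ! i \<noteq> u ! i}" by auto
    ultimately show "(v, u) \<in> parcs (fib_run_graph n)" by (simp add: fib_run_graph_def)
  qed
  then show "symmetric (with_proj (fib_run_graph n))"
    by (simp add: symmetric_def)
qed (auto simp: fib_run_graph_def finite_fib_run_verts)

lemma run_constrained_remove_first:
  assumes s: "run_constrained s" and p: "p < length s" "s ! p"
    and before: "\<And>q. q < p \<Longrightarrow> \<not> s ! q"
  shows "run_constrained (s[p := False])"
  unfolding run_constrained_def
proof (intro allI impI)
  fix i j assume m: "maximal_run True (s[p := False]) i j"
  have ip: "p < i"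
  proof (rule ccontr)
    assume "\<not> p < i"
    moreover have "s[p := False] ! i" using m by (auto simp: maximal_run_def)
    ultimately show False using before[of i] p by (cases "i = p") auto
  qed
  define i' where "i' = (if i = Suc p then p else i)"
  have "maximal_run True s i' j"
  proof (cases "i = Suc p")
    case True
    have "s ! q" if "p \<le> q" "q < j" for q
      using that m p True by (cases "q = p") (auto simp: maximal_run_def)
    then show ?thesis using m p True before[of "p - 1"]
      by (auto simp: maximal_run_def i'_def)
  next
    case False
    then have "i - 1 \<noteq> p" using ip by simp
    then show ?thesis using m ip False by (auto simp: maximal_run_def i'_def)
  qed
  then obtain k where k: "maximal_run False s j k" "k - j > j - i'"
    using s by (auto simp: run_constrained_def)
  have "j - 1 > p" "j - 1 < length s" "i < j" using m ip by (auto simp: maximal_run_def)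
  then have "maximal_run False (s[p := False]) j k"
    using k by (auto simp: maximal_run_def)
  moreover have "j - i \<le> j - i'" using ip by (auto simp: i'_def)
  ultimately show "\<exists>k. maximal_run False (s[p := False]) j k \<and> k - j > j - i"
    using k by (intro exI[of _ k]) simp
qed

lemma zeros_in_fib_run_verts: "replicate n False \<in> fib_run_verts n"
proof -
  define s where "s = replicate n False @ [False, False]"
  have "\<not> s ! q" if "q < length s" for q
  proof -
    have "s ! q \<in> set s" using that by (rule nth_mem)
    then show ?thesis by (auto simp: s_def)
  qed
  then have "\<not> maximal_run True s i j" for i j
    unfolding maximal_run_def by (meson less_le_trans order_refl)
  then show ?thesis by (simp add: fib_run_verts_def run_constrained_def s_def)
qed

lemma fib_run_graph_reaches_zeros:
  assumes "r \<in> fib_run_verts n"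
  shows "r \<rightarrow>\<^sup>*\<^bsub>with_proj (fib_run_graph n)\<^esub> replicate n False"
  using assms
proof (induction "card {i. i < n \<and> r ! i}" arbitrary: r rule: less_induct)
  case less
  interpret pair_graph "fib_run_graph n" by (rule pair_graph_fib_run_graph)
  have len: "length r = n" using less.prems by (simp add: fib_run_verts_def)
  show ?case
  proof (cases "\<exists>i<n. r ! i")
    case False
    then have eq: "r = replicate n False" using len by (auto intro: nth_equalityI)
    have "r \<in> pverts (fib_run_graph n)" using less.prems by (simp add: fib_run_graph_def)
    then show ?thesis unfolding eq by (intro reachable_refl) simp
  next
    case True
    define p where "p = (LEAST i. i < n \<and> r ! i)"
    have p: "p < n" "r ! p" using LeastI_ex[OF True] by (auto simp: p_def)
    have before: "\<not> r ! q" if "q < p" for q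
      using not_less_Least[of q "\<lambda>i. i < n \<and> r ! i"] that p by (auto simp: p_def)
    define r' where "r' = r[p := False]"
    have "run_constrained ((r @ [False, False])[p := False])"
      using less.prems p before len
      by (intro run_constrained_remove_first) (auto simp: fib_run_verts_def nth_append)
    then have r': "r' \<in> fib_run_verts n"
      using p len by (simp add: fib_run_verts_def r'_def list_update_append)
    have "{i. i < n \<and> r ! i \<noteq> r' ! i} = {p}"
      using p len by (auto simp: r'_def nth_list_update split: if_splits)
    then have arc: "(r, r') \<in> parcs (fib_run_graph n)"
      using less.prems r' by (simp add: fib_run_graph_def)
    have "{i. i < n \<and> r' ! i} \<subset> {i. i < n \<and> r ! i}"
      using p len by (auto simp: r'_def nth_list_update split: if_splits)
    then have "card {i. i < n \<and> r' ! i} < card {i. i < n \<and> r ! i}"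
      by (intro psubset_card_mono) auto
    from less.hyps[OF this r'] arc show ?thesis
      by (intro adj_reachable_trans[of r r']) auto
  qed
qed

lemma strongly_connected_fib_run_graph: "strongly_connected (with_proj (fib_run_graph n))"
  unfolding strongly_connected_def
proof (intro conjI ballI)
  interpret pair_graph "fib_run_graph n" by (rule pair_graph_fib_run_graph)
  show "verts (with_proj (fib_run_graph n)) \<noteq> {}"
    using zeros_in_fib_run_verts[of n] by (auto simp: fib_run_graph_def)
  fix u v assume "u \<in> verts (with_proj (fib_run_graph n))"
    and "v \<in> verts (with_proj (fib_run_graph n))"
  then have "u \<in> fib_run_verts n" "v \<in> fib_run_verts n"
    by (simp_all add: fib_run_graph_def)
  then show "u \<rightarrow>\<^sup>*\<^bsub>with_proj (fib_run_graph n)\<^esub> v"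
    using fib_run_graph_reaches_zeros symmetric_reachable[OF sym_arcs] reachable_trans
    by blast
qed

end

theory Submission
  imports Defs
begin

text \<open>
  Flipping one bit can neither split nor merge runs of ones in such a way that two ones that stay in
  place pass from the same run to different runs or back, since the string would then contain a
  single zero between ones. Hence if all common ones of two vertices \<open>u\<close> and \<open>v\<close> lie in one run of
  \<open>u\<close> but in pairwise different runs of \<open>v\<close>, a walk from \<open>u\<close> to \<open>v\<close> keeps at most one of them in
  place and has length at least \<open>|u| + |v| - 2\<close>, where \<open>|u|\<close> is the number of ones.

  To make this number large, let \<open>u\<close> begin with a long run of ones, against which \<open>v\<close> has \<open>100100\<dots>\<close>,
  and continue both strings by runs of ones of increasing length, each placed against the zeros
  that follow the previous run in the other string. Only at the very end do both strings vanish,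
  and the many common ones at the beginning outweigh this loss.
\<close>

section \<open>Ones and runs under a single flip\<close>

definition ones :: "bool list \<Rightarrow> nat set" where
  "ones r = {i. i < length r \<and> r ! i}"

text \<open>Meant for \<open>p \<le> q\<close>. It holds vacuously for \<open>q < p\<close>, so
  equivalences between its instances may range over all ordered pairs.\<close>

definition same_run :: "bool list \<Rightarrow> nat \<Rightarrow> nat \<Rightarrow> bool" where
  "same_run r p q \<longleftrightarrow> (\<forall>k. p \<le> k \<and> k \<le> q \<longrightarrow> r ! k)"

lemma finite_ones [simp]: "finite (ones r)"
  by (simp add: ones_def)

lemma card_ones: "card (ones r) = length (filter (\<lambda>b. b) r)"
  by (simp add: ones_def length_filter_conv_card)

lemma maximal_run_ending_at:
  assumes "0 < j" "j \<le> length s" "s ! (j - 1) = b" "j = length s \<or> s ! j \<noteq> b"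
  shows "\<exists>i. maximal_run b s i j"
proof -
  define P where "P i \<longleftrightarrow> (\<forall>p. i \<le> p \<and> p < j \<longrightarrow> s ! p = b)" for i
  define i where "i = (LEAST i. P i)"
  have P1: "P (j - 1)"
  proof -
    have "p = j - 1" if "j - 1 \<le> p" "p < j" for p using that by linarith
    then show ?thesis using assms(3) by (auto simp: P_def)
  qed
  then have "P i" unfolding i_def by (rule LeastI)
  have "i \<le> j - 1" unfolding i_def using P1 by (rule Least_le)
  then have "i < j" using assms(1) by linarith
  have "s ! (i - 1) \<noteq> b" if "0 < i"
  proof
    assume eq: "s ! (i - 1) = b"
    have "P (i - 1)" unfolding P_def
    proof (intro allI impI)
      fix p assume "i - 1 \<le> p \<and> p < j"
      then have "p = i - 1 \<or> i \<le> p \<and> p < j" by linarith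
      then show "s ! p = b" using eq \<open>P i\<close> unfolding P_def by blast
    qed
    then have "i \<le> i - 1" unfolding i_def by (rule Least_le)
    then show False using that by linarith
  qed
  then have "i = 0 \<or> s ! (i - 1) \<noteq> b" by blast
  then have "maximal_run b s i j"
    using \<open>P i\<close> \<open>i < j\<close> assms(2,4) unfolding maximal_run_def P_def by (intro conjI)
  then show ?thesis ..
qed

lemma maximal_run_starting_at:
  assumes "i < m" "m \<le> length s" "\<And>p. i \<le> p \<Longrightarrow> p < m \<Longrightarrow> s ! p = b"
    "i = 0 \<or> s ! (i - 1) \<noteq> b"
  shows "\<exists>k\<ge>m. maximal_run b s i k"
proof -
  define P where "P k \<longleftrightarrow> k \<le> length s \<and> (\<forall>p. i \<le> p \<and> p < k \<longrightarrow> s ! p = b)" for k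
  define k where "k = (GREATEST k. P k)"
  have Pm: "P m" using assms by (auto simp: P_def)
  have bd: "\<And>k. P k \<Longrightarrow> k \<le> length s" by (simp add: P_def)
  have Pk: "P k" unfolding k_def using Pm bd by (rule GreatestI_nat)
  have km: "m \<le> k" unfolding k_def using Pm bd by (rule Greatest_le_nat)
  have "k = length s \<or> s ! k \<noteq> b"
  proof (rule ccontr)
    assume "\<not> ?thesis"
    then have "P (Suc k)" using Pk by (auto simp: P_def less_Suc_eq)
    then have "Suc k \<le> k" unfolding k_def using bd by (rule Greatest_le_nat)
    then show False by simp
  qed
  then show ?thesis
    using Pk km assms(1,4) unfolding maximal_run_def P_def by (intro exI[of _ k]) auto
qed

lemma same_run_flip:
  assumes r': "r' \<in> fib_run_verts n" and len: "length r = n"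
    and flip: "{i. i < n \<and> r ! i \<noteq> r' ! i} = {t}"
    and q: "q < n" and ends: "r' ! p" "r' ! q"
    and same: "same_run r p q"
  shows "same_run r' p q"
proof (rule ccontr)
  assume "\<not> same_run r' p q"
  then obtain k where k: "p \<le> k" "k \<le> q" "\<not> r' ! k" by (auto simp: same_run_def)
  have kpq: "p < k" "k < q" using k ends by (metis le_neq_implies_less)+
  have eq: "r' ! i = r ! i" if "i \<noteq> k" "i < n" for i
  proof -
    have "r ! k" using same k by (auto simp: same_run_def)
    then have "k \<in> {i. i < n \<and> r ! i \<noteq> r' ! i}" using k q by auto
    then have "k = t" using flip by blast
    then show ?thesis using flip that by blast
  qed
  define s where "s = r' @ [False, False]"
  have len': "length r' = n" and rc: "run_constrained s"
    using r' by (auto simp: fib_run_verts_def s_def)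
  \<comment> \<open>The flipped \<open>k\<close> lies strictly between \<open>p\<close> and
    \<open>q\<close>, so its neighbours are unflipped ones. Yet the run of ones ending at
    \<open>k\<close> demands at least two zeros after it.\<close>
  have "p \<le> k - 1" "k - 1 \<le> q" "p \<le> Suc k" "Suc k \<le> q" "k - 1 \<noteq> k" "Suc k \<noteq> k"
    using kpq by linarith+
  then have "r' ! (k - 1)" "r' ! Suc k"
    using eq[of "k - 1"] eq[of "Suc k"] same q by (auto simp: same_run_def)
  then have s: "s ! (k - 1)" "\<not> s ! k" "s ! Suc k"
    using kpq q k len' by (auto simp: s_def nth_append)
  obtain i where i: "maximal_run True s i k"
    using maximal_run_ending_at[of k s True] s kpq q len' by (auto simp: s_def)
  then obtain m where m: "maximal_run False s k m" "m - k > k - i"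
    using rc by (auto simp: run_constrained_def)
  have "Suc k < m" using m i by (auto simp: maximal_run_def)
  then have "\<not> s ! Suc k" using m by (auto simp: maximal_run_def)
  then show False using s by simp
qed

lemma same_run_flip_iff:
  assumes "r \<in> fib_run_verts n" "r' \<in> fib_run_verts n"
    and flip: "{i. i < n \<and> r ! i \<noteq> r' ! i} = {t}"
    and "p \<in> ones r" "q \<in> ones r" "p \<in> ones r'" "q \<in> ones r'"
  shows "same_run r p q \<longleftrightarrow> same_run r' p q"
proof
  have len: "length r = n" "length r' = n" using assms(1,2) by (auto simp: fib_run_verts_def)
  have pq: "q < n" "r ! p" "r ! q" "r' ! p" "r' ! q" using assms(4-7) len by (auto simp: ones_def)
  show "same_run r p q \<Longrightarrow> same_run r' p q"
    by (rule same_run_flip[OF assms(2) len(1) flip pq(1,4,5)])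
  have flip': "{i. i < n \<and> r' ! i \<noteq> r ! i} = {t}" using flip by blast
  show "same_run r' p q \<Longrightarrow> same_run r p q"
    by (rule same_run_flip[OF assms(1) len(2) flip' pq(1,2,3)])
qed

section \<open>Lower bounds for walk lengths\<close>

text \<open>
  The set \<open>R\<close> consists of the ones of the starting vertex that no step of the walk flips; every
  other common one of both ends is flipped at least twice.
\<close>

lemma awalk_retained_ones:
  assumes "pre_digraph.awalk (with_proj (fib_run_graph n)) u p v"
  shows "\<exists>R \<subseteq> ones u \<inter> ones v. card (ones u) + card (ones v) \<le> length p + 2 * card R \<and>
    (\<forall>x\<in>R. \<forall>y\<in>R. same_run u x y \<longleftrightarrow> same_run v x y)"
  using assms
proof (induction p arbitrary: u)
  interpret pair_graph "fib_run_graph n" by (rule pair_graph_fib_run_graph)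
  case Nil
  then have "u = v" by (simp add: awalk_Nil_iff)
  then show ?case by (intro exI[of _ "ones v"]) auto
next
  interpret pair_graph "fib_run_graph n" by (rule pair_graph_fib_run_graph)
  case (Cons e p)
  define w where "w = snd e"
  have e: "(u, w) \<in> parcs (fib_run_graph n)" and w: "awalk w p v"
    using Cons.prems by (simp_all add: awalk_Cons_iff w_def)
  obtain R where R: "R \<subseteq> ones w \<inter> ones v"
    "card (ones w) + card (ones v) \<le> length p + 2 * card R"
    "\<forall>x\<in>R. \<forall>y\<in>R. same_run w x y \<longleftrightarrow> same_run v x y"
    using Cons.IH[OF w] by blast
  have uw: "u \<in> fib_run_verts n" "w \<in> fib_run_verts n"
    and "card {i. i < n \<and> u ! i \<noteq> w ! i} = 1"
    using e by (auto simp: fib_run_graph_def)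
  then obtain t where t: "{i. i < n \<and> u ! i \<noteq> w ! i} = {t}" by (auto simp: card_1_singleton_iff)
  have len: "length u = n" "length w = n" using uw by (auto simp: fib_run_verts_def)
  have "t \<in> {i. i < n \<and> u ! i \<noteq> w ! i}" using t by simp
  then have tn: "t < n" "u ! t \<noteq> w ! t" by auto
  have other: "u ! i = w ! i" if "i < n" "i \<noteq> t" for i using t that by blast
  have finR: "finite R" by (rule finite_subset[OF R(1)]) simp
  define R' where "R' = R - {t}"
  have "R' \<subseteq> ones u" using R(1) other len by (auto simp: R'_def ones_def)
  then have sub: "R' \<subseteq> ones u \<inter> ones v" "R' \<subseteq> ones w" using R(1) by (auto simp: R'_def)
  have runs: "same_run u x y \<longleftrightarrow> same_run v x y" if "x \<in> R'" "y \<in> R'" for x y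
  proof -
    have "same_run u x y \<longleftrightarrow> same_run w x y"
      using that sub by (intro same_run_flip_iff[OF uw t]) blast+
    moreover have "same_run w x y \<longleftrightarrow> same_run v x y" using R(3) that by (simp add: R'_def)
    ultimately show ?thesis by simp
  qed
  have "card (ones u) + card (ones v) \<le> length (e # p) + 2 * card R'"
  \<comment> \<open>If the step creates a one, losing \<open>t\<close> from \<open>R\<close> costs
    at most 2, balanced by the longer walk and by \<open>u\<close> having one less one than
    \<open>w\<close>. If it deletes a one, \<open>t\<close> was not in \<open>R\<close> and the
    longer walk pays for it.\<close>
  proof (cases "w ! t")
    case True
    have "ones w = insert t (ones u)" "t \<notin> ones u"
      using True tn other len by (auto simp: ones_def)
    then have "card (ones w) = Suc (card (ones u))" by simp
    moreover have "card R \<le> Suc (card R')"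
      using finR unfolding R'_def by (cases "t \<in> R") (simp_all add: card_Diff_singleton_if)
    ultimately show ?thesis using R(2) by simp
  next
    case False
    have "ones u = insert t (ones w)" "t \<notin> ones w"
      using False tn other len by (auto simp: ones_def)
    then have "card (ones u) = Suc (card (ones w))" "R' = R" using R(1) by (auto simp: R'_def)
    then show ?thesis using R(2) by simp
  qed
  then show ?case using sub runs by (intro exI[of _ R']) blast
qed

lemma diam_ge_card_ones:
  assumes u: "u \<in> fib_run_verts n" and v: "v \<in> fib_run_verts n"
    and sep: "\<And>p q. p \<in> ones u \<inter> ones v \<Longrightarrow> q \<in> ones u \<inter> ones v \<Longrightarrow> p < q \<Longrightarrow>
      same_run u p q \<and> \<not> same_run v p q"
  shows "diam (with_proj (fib_run_graph n)) \<ge> ereal (real (card (ones u) + card (ones v)) - 2)"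
proof -
  interpret pair_graph "fib_run_graph n" by (rule pair_graph_fib_run_graph)
  have cost: "awalk_cost (\<lambda>_. 1) p = real (length p)" for p :: "(bool list \<times> bool list) list"
    by (induction p) auto
  have "real (card (ones u) + card (ones v)) - 2 \<le> real (length p)" if p: "awalk u p v" for p
  proof -
    obtain R where R: "R \<subseteq> ones u \<inter> ones v"
      "card (ones u) + card (ones v) \<le> length p + 2 * card R"
      "\<forall>x\<in>R. \<forall>y\<in>R. same_run u x y \<longleftrightarrow> same_run v x y"
      using awalk_retained_ones[OF p] by blast
    \<comment> \<open>Retained ones share a run in \<open>u\<close> exactly if they do in
      \<open>v\<close>, which \<open>sep\<close> excludes for two distinct ones.\<close>
    have "x = y" if "x \<in> R" "y \<in> R" for x y
      using sep[of x y] sep[of y x] R that by (meson linorder_neqE_nat subsetD)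
    then have "card R \<le> 1" by (metis card.infinite card_le_Suc0_iff_eq le0 One_nat_def)
    then show ?thesis using R(2) by simp
  qed
  then have "ereal (real (card (ones u) + card (ones v)) - 2)
      \<le> graph_dist (with_proj (fib_run_graph n)) u v"
    unfolding graph_dist_def \<mu>_def cost by (intro INF_greatest) simp
  also have "\<dots> \<le> diam (with_proj (fib_run_graph n))"
    unfolding diam_def using u v
    by (intro SUP_upper2[of u] SUP_upper2[of v]) (auto simp: fib_run_graph_def)
  finally show ?thesis .
qed

section \<open>Run-constrained strings built from blocks\<close>

text \<open>As \<open>z > 0\<close>, a run of ones is either the leading block or lies inside
  \<open>w\<close>. The former is followed by at least \<open>z\<close> zeros, since zeros at the
  start of \<open>w\<close> only lengthen that run; the latter keeps its zeros.\<close>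

lemma run_constrained_block:
  assumes lz: "l < z" and w: "run_constrained w"
  shows "run_constrained (replicate l True @ replicate z False @ w)"
  unfolding run_constrained_def
proof (intro allI impI)
  define s where "s = replicate l True @ replicate z False @ w"
  fix i j assume m: "maximal_run True (replicate l True @ replicate z False @ w) i j"
  then have m: "maximal_run True s i j" by (simp add: s_def)
  have s1: "s ! p" if "p < l" for p using that by (simp add: s_def nth_append)
  have s0: "\<not> s ! p" if "l \<le> p" "p < l + z" for p using that by (auto simp: s_def nth_append)
  have s2: "s ! (l + z + p) = w ! p" for p by (simp add: s_def nth_append)
  have ls: "length s = l + z + length w" by (simp add: s_def)
  have ij: "i < j" "j \<le> length s" "\<And>p. i \<le> p \<Longrightarrow> p < j \<Longrightarrow> s ! p"
    "i = 0 \<or> \<not> s ! (i - 1)" "j = length s \<or> \<not> s ! j"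
    using m by (auto simp: maximal_run_def)
  have "\<exists>k. maximal_run False s j k \<and> k - j > j - i"
  proof (cases "i < l")
    case True
    have "i = 0" using ij(4) s1[of "i - 1"] True by auto
    have "\<not> j < l" using ij(5) s1[of j] ls lz by auto
    moreover have "\<not> l < j" using ij(3)[of l] s0[of l] True lz by auto
    ultimately have "j = l" by simp
    then obtain k where "l + z \<le> k" "maximal_run False s j k"
      using maximal_run_starting_at[of l "l + z" s False] s0 s1[of "l - 1"] True ls lz by auto
    moreover have "k - j > j - i" using \<open>l + z \<le> k\<close> \<open>i = 0\<close> \<open>j = l\<close> lz by linarith
    ultimately show ?thesis by blast
  next
    case False
    have "l + z \<le> i" using ij(1) ij(3)[of i] s0[of i] False by (meson not_le order_refl)
    then obtain i' where i': "i = l + z + i'" using le_Suc_ex by blast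
    obtain j' where j': "j = l + z + j'" using i' ij(1) le_Suc_ex[of "l + z" j] by auto
    have "maximal_run True w i' j'"
      unfolding maximal_run_def
    proof (intro conjI allI impI)
      fix p assume "i' \<le> p \<and> p < j'"
      then show "w ! p = True" using ij(3)[of "l + z + p"] by (simp add: i' j' s2)
    next
      show "i' = 0 \<or> w ! (i' - 1) \<noteq> True"
        using ij(4) s2[of "i' - 1"] i' lz by (cases i') auto
    next
      show "j' = length w \<or> w ! j' \<noteq> True" using ij(5) s2[of j'] j' ls by auto
    qed (use ij i' j' ls in auto)
    then obtain k where k: "maximal_run False w j' k" "k - j' > j' - i'"
      using w unfolding run_constrained_def by blast
    have "maximal_run False s j (l + z + k)"
      unfolding maximal_run_def
    proof (intro conjI allI impI)
      fix p assume p: "j \<le> p \<and> p < l + z + k"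
      then obtain p' where "p = l + z + p'" using j' le_Suc_ex[of "l + z" p] by auto
      then show "s ! p = False" using k(1) p j' s2[of p'] by (auto simp: maximal_run_def)
    next
      show "j = 0 \<or> s ! (j - 1) \<noteq> False" using ij(1) ij(3)[of "j - 1"] by auto
    next
      show "l + z + k = length s \<or> s ! (l + z + k) \<noteq> False"
        using k(1) s2[of k] ls by (auto simp: maximal_run_def)
    qed (use k j' ls in \<open>auto simp: maximal_run_def\<close>)
    then show ?thesis using k i' j' by (intro exI[of _ "l + z + k"]) auto
  qed
  then show "\<exists>k. maximal_run False (replicate l True @ replicate z False @ w) j k \<and> k - j > j - i"
    by (simp add: s_def)
qed

lemma run_constrained_concat_blocks:
  assumes "run_constrained w"
  shows "run_constrained (concat (replicate c [True, False, False]) @ w)"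
proof (induction c)
  case (Suc c)
  then show ?case using run_constrained_block[of 1 2] by (simp add: numeral_2_eq_2)
qed (simp add: assms)

lemma run_constrained_replicate_False:
  assumes "run_constrained w"
  shows "run_constrained (replicate z False @ w)"
  using run_constrained_block[of 0 z w] assms by (cases z) auto

lemma run_constrained_Nil: "run_constrained []"
  by (simp add: run_constrained_def maximal_run_def)

section \<open>Complementary alternating strings\<close>

text \<open>The two vertices use this with the same list and opposite \<open>b\<close>, so that the
  runs of ones of each face the runs of zeros of the other.\<close>

fun alternate :: "bool \<Rightarrow> nat list \<Rightarrow> bool list" where
  "alternate b [] = []"
| "alternate b (a # as) = replicate a b @ alternate (\<not> b) as"

lemma length_alternate [simp]: "length (alternate b as) = sum_list as"
  by (induction as arbitrary: b) auto

lemma nth_alternate_not: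
  "p < sum_list as \<Longrightarrow> alternate (\<not> b) as ! p \<longleftrightarrow> \<not> alternate b as ! p"
proof (induction as arbitrary: b p)
  case (Cons a as)
  then show ?case using Cons.IH[of "p - a" "\<not> b"] by (auto simp: nth_append)
qed simp

lemma count_alternate:
  "length (filter (\<lambda>b. b) (alternate b as)) + length (filter (\<lambda>b. b) (alternate (\<not> b) as))
    = sum_list as"
proof (induction as arbitrary: b)
  case (Cons a as)
  then show ?case using Cons.IH[of "\<not> b"] by (cases b) auto
qed simp

text \<open>
  The block \<open>w\<close> consists of the last \<open>h - 1\<close> positions of a vertex and of the two zeros appended to it.
\<close>

lemma run_constrained_alternate:
  assumes "sorted_wrt (<) (r # ys)" "\<forall>y\<in>set (r # ys). y \<le> 2 * h"
  defines "w \<equiv> replicate (Suc h) False"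
  shows "run_constrained (replicate r True @ alternate False (ys @ [h]) @ w) \<and>
    run_constrained (alternate True (ys @ [h]) @ w)"
  using assms(1,2)
proof (induction ys arbitrary: r)
  case Nil
  \<comment> \<open>After the \<open>r \<le> 2 * h\<close> ones come \<open>h\<close> zeros, facing
    the last run of the other string, and the \<open>h + 1\<close> zeros of
    \<open>w\<close>.\<close>
  have "run_constrained (replicate r True @ replicate (h + Suc h) False @ [])"
    using Nil by (intro run_constrained_block run_constrained_Nil) simp
  moreover have "run_constrained (replicate h True @ replicate (Suc h) False @ [])"
    by (intro run_constrained_block run_constrained_Nil) simp
  moreover have "replicate (h + Suc h) False = replicate h False @ w"
    by (simp only: w_def replicate_add)
  ultimately show ?case unfolding w_def[symmetric] by simp
next
  case (Cons y ys)
  \<comment> \<open>The strings exchange roles: the run of \<open>r\<close> ones is followed by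
    \<open>y > r\<close> zeros, and the other string starts with \<open>y\<close> ones, the next
    value of \<open>r\<close>.\<close>
  have IH: "run_constrained (replicate y True @ alternate False (ys @ [h]) @ w)"
    "run_constrained (alternate True (ys @ [h]) @ w)"
    using Cons.IH[of y] Cons.prems by auto
  have "run_constrained (replicate r True @ replicate y False @ alternate True (ys @ [h]) @ w)"
    using Cons.prems IH(2) by (intro run_constrained_block) auto
  then show ?case using IH(1) by simp
qed

section \<open>Increasing lists with a given sum\<close>

text \<open>The hypotheses, doubled to avoid halves, place \<open>N\<close> between the least and
  the greatest sum of \<open>j\<close> distinct numbers from \<open>r + 1\<close> to
  \<open>m\<close>. Choosing entries greedily from the largest down reaches every sum between
  these.\<close>

lemma ex_sorted_sum_list:
  fixes r m N j :: nat
  assumes "2 * r * j + j * (j + 1) \<le> 2 * N" "2 * N + j * (j - 1) \<le> 2 * m * j"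
  shows "\<exists>ys. sorted_wrt (<) (r # ys) \<and> (\<forall>y\<in>set ys. y \<le> m) \<and> sum_list ys = N"
  using assms
proof (induction j arbitrary: m N)
  case 0
  then show ?case by (intro exI[of _ "[]"]) simp
next
  case (Suc j)
  have "even (j * (j + 1))" by simp
  then obtain K where K: "j * (j + 1) = 2 * K" by (elim evenE)
  have Kj: "2 * K = j * j + j" using K by (simp add: algebra_simps)
  have jj: "j * (j - 1) + 2 * j = 2 * K" using Kj by (cases j) (auto simp: algebra_simps)
  have lo: "r * j + r + K + j + 1 \<le> N" using Suc.prems(1) Kj by (simp add: algebra_simps)
  have hi: "N + K \<le> m * j + m" using Suc.prems(2) Kj by (simp add: algebra_simps)
  \<comment> \<open>The \<open>j\<close> remaining entries have the least sum
    \<open>r * j + K\<close>; \<open>y\<close> is as large as this and \<open>m\<close>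
    permit.\<close>
  define y where "y = min m (N - (r * j + K))"
  have ry: "r + j < y"
  proof -
    have "(r + j + 1) * (j + 1) \<le> m * (j + 1)"
      using lo hi Kj by (simp add: algebra_simps)
    then have "r + j + 1 \<le> m" by (simp only: mult_le_cancel2)
    then show ?thesis using lo by (simp add: y_def)
  qed
  have yN: "y \<le> m" "r * j + K + y \<le> N" using lo by (auto simp: y_def)
  \<comment> \<open>This bounds \<open>N - y\<close> by the greatest sum of \<open>j\<close>
    distinct numbers below \<open>y\<close>. If \<open>m\<close> does not limit \<open>y\<close>,
    then \<open>N - y\<close> is exactly the least sum.\<close>
  have up: "N + K \<le> y * j + y"
  proof (cases "m \<le> N - (r * j + K)")
    case True
    then show ?thesis using hi by (simp add: y_def min_def)
  next
    case False
    then have N: "N = r * j + K + y" using lo by (simp add: y_def)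
    have "(r + j + 1) * j \<le> y * j" using ry by (intro mult_right_mono) auto
    then show ?thesis using Kj unfolding N by (simp add: algebra_simps)
  qed
  obtain z where z: "y = Suc z" using ry by (cases y) auto
  have "2 * r * j + j * (j + 1) \<le> 2 * (N - y)" using yN K by simp
  moreover have "2 * (N - y) + j * (j - 1) \<le> 2 * z * j"
    using up jj yN unfolding z by (simp add: algebra_simps)
  ultimately obtain ys where ys: "sorted_wrt (<) (r # ys)" "\<forall>x\<in>set ys. x \<le> z"
    "sum_list ys = N - y"
    using Suc.IH by blast
  have "sorted_wrt (<) (r # (ys @ [y]))" using ys ry z by (auto simp: sorted_wrt_append)
  moreover have "\<forall>x\<in>set (ys @ [y]). x \<le> m" using ys z yN by auto
  moreover have "sum_list (ys @ [y]) = N" using ys yN by simp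
  ultimately show ?case by blast
qed

section \<open>The two distant vertices\<close>

text \<open>In exponent notation \<open>u\<close> is \<open>0^s 1^L 0^a 1^y1 0^y2 ...\<close> and
  \<open>v\<close> is \<open>1^s Q 1^a 0^y1 1^y2 ...\<close> with
  \<open>Q = 1 0^(s+2+x) (100)^c 1^e\<close>; both end with \<open>h - 1\<close> zeros. The last
  \<open>e\<close> ones of \<open>Q\<close> join the next run, hence \<open>e + a\<close>. The
  parameters \<open>s\<close> and \<open>x\<close> adjust the length without affecting
  \<open>h - c - e\<close>.\<close>

lemma diam_ge_increasing_runs:
  fixes s x e c a h :: nat and ys :: "nat list"
  defines "L \<equiv> s + 3 + x + 3 * c + e"
  assumes e: "e \<le> 1" and La: "L < a" and h: "0 < h"
    and ys: "sorted_wrt (<) ((e + a) # ys)" "\<forall>y\<in>set ((e + a) # ys). y \<le> 2 * h"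
    and n: "n = s + L + a + sum_list ys + h + (h - 1)"
  shows "diam (with_proj (fib_run_graph n)) \<ge> ereal (real n - real h + real c + real e)"
proof -
  define Q where "Q = True # replicate (s + 2 + x) False @
    concat (replicate c [True, False, False]) @ replicate e True"
  define as where "as = a # ys @ [h]"
  define Z where "Z = replicate (h - 1) False"
  define u where "u = replicate s False @ replicate L True @ alternate False as @ Z"
  define v where "v = replicate s True @ Q @ alternate True as @ Z"
  have ZZ: "Z @ [False, False] = replicate (Suc h) False"
  proof -
    have "Suc h = (h - 1) + 2" using h by simp
    then show ?thesis unfolding Z_def by (simp only: replicate_add) (simp add: numeral_2_eq_2)
  qed
  have len100: "length (concat (replicate c [True, False, False])) = 3 * c" for c
    by (induction c) auto
  have LQ: "length Q = L" by (simp add: Q_def L_def len100)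
  have lu: "length u = n" and lv: "length v = n"
    by (simp_all add: u_def v_def n LQ as_def Z_def)
  have rc: "run_constrained
      (replicate (e + a) True @ alternate False (ys @ [h]) @ Z @ [False, False])"
    "run_constrained (alternate True (ys @ [h]) @ Z @ [False, False])"
    using run_constrained_alternate[OF ys] unfolding ZZ by auto
  have "run_constrained
      (replicate L True @ replicate a False @ alternate True (ys @ [h]) @ Z @ [False, False])"
    using La rc by (intro run_constrained_block)
  then have "run_constrained (replicate s False @
      (replicate L True @ replicate a False @ alternate True (ys @ [h]) @ Z @ [False, False]))"
    by (rule run_constrained_replicate_False)
  then have u: "u \<in> fib_run_verts n"
    using lu by (simp add: fib_run_verts_def u_def as_def)
  \<comment> \<open>The first one of \<open>Q\<close> joins the \<open>s\<close> ones before it in a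
    run of \<open>s + 1\<close>.\<close>
  have shift: "replicate (Suc s) True @ w = replicate s True @ True # w" for w
    by (simp add: replicate_app_Cons_same)
  have "run_constrained (replicate (Suc s) True @ replicate (s + 2 + x) False @
      concat (replicate c [True, False, False]) @
      (replicate (e + a) True @ alternate False (ys @ [h]) @ Z @ [False, False]))"
    using rc by (intro run_constrained_block run_constrained_concat_blocks) auto
  then have v: "v \<in> fib_run_verts n"
    using lv unfolding shift by (simp add: fib_run_verts_def v_def as_def Q_def replicate_add)
  \<comment> \<open>Before this window \<open>u\<close> has only zeros; after it the alternating
    strings are complementary and the final zeros are shared.\<close>
  have overlap: "s \<le> p \<and> p < s + L" if "p \<in> ones u \<inter> ones v" for p
  proof (rule ccontr)
    assume neg: "\<not> ?thesis"
    have p: "p < n" "u ! p" "v ! p" using that lu by (auto simp: ones_def)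
    have "\<not> p < s" using p by (auto simp: u_def nth_append)
    then have "s + L \<le> p" using neg by simp
    then obtain q where q: "p = s + L + q" using le_Suc_ex by blast
    have "u ! p = (alternate False as @ Z) ! q" "v ! p = (alternate True as @ Z) ! q"
      by (simp_all add: u_def v_def q nth_append LQ)
    moreover have "q < sum_list as + (h - 1)" using p q by (simp add: n as_def)
    ultimately show False
      using p nth_alternate_not[of q as False] by (auto simp: nth_append Z_def split: if_splits)
  qed
  have same: "same_run u p q" if "s \<le> p" "q < s + L" for p q
    using that by (auto simp: same_run_def u_def nth_append)
  have "successively (\<lambda>x y. \<not> (x \<and> y)) Q"
  proof -
    have zeros: "successively (\<lambda>x y. \<not> (x \<and> y)) (replicate z False)" for z
      by (induction z) (auto simp: successively_Cons)
    \<comment> \<open>With \<open>z\<close> general, the two zeros closing a block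
      \<open>100\<close> serve as the leading zeros of the rest.\<close>
    have blocks: "successively (\<lambda>x y. \<not> (x \<and> y))
        (replicate z False @ concat (replicate c [True, False, False]) @ replicate e True)"
      if "0 < z" for z
      using that
    proof (induction c arbitrary: z)
      case 0
      then show ?case using e zeros by (cases e) (auto simp: successively_append_iff)
    next
      case (Suc c)
      show ?case using Suc.IH[of 2] Suc.prems zeros
        by (auto simp: successively_append_iff successively_Cons numeral_2_eq_2)
    qed
    show ?thesis using blocks[of "s + 2 + x"] by (simp add: Q_def successively_Cons)
  qed
  then have sparse: "\<not> (Q ! p \<and> Q ! Suc p)" if "Suc p < L" for p
    using that LQ by (simp add: successively_conv_nth)
  have "same_run u p q \<and> \<not> same_run v p q"
    if pq: "p \<in> ones u \<inter> ones v" "q \<in> ones u \<inter> ones v" "p < q" for p q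
  proof
    have b: "s \<le> p" "q < s + L" using overlap pq by auto
    then show "same_run u p q" by (rule same)
    obtain p' where p': "p = s + p'" using b le_Suc_ex by blast
    have "v ! (s + k) = Q ! k" if "k < L" for k using that by (simp add: v_def nth_append LQ)
    then have "\<not> (v ! p \<and> v ! Suc p)"
      using sparse[of p'] b pq(3) p'
      by (metis add_Suc_right add_less_cancel_left less_trans_Suc Suc_lessD)
    moreover have "v ! p \<and> v ! Suc p" if "same_run v p q"
      using that pq(3) by (simp add: same_run_def)
    ultimately show "\<not> same_run v p q" by blast
  qed
  from diam_ge_card_ones[OF u v this]
  have "ereal (real (card (ones u) + card (ones v)) - 2) \<le> diam (with_proj (fib_run_graph n))"
    by blast
  \<comment> \<open>Every position but the last \<open>h - 1\<close> is a one of \<open>u\<close> or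
    \<open>v\<close>; the \<open>1 + c + e\<close> ones of \<open>Q\<close> count twice.\<close>
  moreover have "card (ones u) + card (ones v) = n + 2 + c + e - h"
  proof -
    have c100: "length (filter (\<lambda>b. b) (concat (replicate c [True, False, False]))) = c" for c
      by (induction c) auto
    show ?thesis using count_alternate[of False as] h
      by (simp add: card_ones u_def v_def Q_def Z_def n c100 as_def L_def)
  qed
  moreover have "h \<le> n" by (simp add: n)
  ultimately show ?thesis by (simp add: of_nat_diff algebra_simps)
qed

section \<open>Choice of parameters\<close>

text \<open>
  For admissible parameters and every \<open>n\<close> between \<open>l\<close> and \<open>u\<close>, the list \<open>ys\<close> above can be chosen
  with \<open>j\<close> entries so that the vertices have length \<open>n\<close>; the bound \<open>n - h + c + e\<close> on the diameter
  then suffices because \<open>(4 * t + 3)\<^sup>2 \<le> 16 + 8 * n\<close> means \<open>t \<le> sqrt (1 + n / 2) - 3 / 4\<close>.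
\<close>

definition admissible ::
  "nat \<Rightarrow> nat \<Rightarrow> nat \<Rightarrow> nat \<Rightarrow> nat \<Rightarrow> nat \<Rightarrow> nat \<Rightarrow> nat \<Rightarrow> nat \<Rightarrow> bool" where
  "admissible l u s x e c a h j \<longleftrightarrow>
     e \<le> 1 \<and> s + 3 + x + 3 * c + e < a \<and> a + e \<le> 2 * h \<and> c + e \<le> h \<and>
     (4 * (h + 1 - c - e) + 3)\<^sup>2 \<le> 16 + 8 * l \<and>
     2 * (2 * s + 2 + x + 3 * c + e + a + 2 * h) + 2 * (a + e) * j + j * (j + 1) \<le> 2 * l \<and>
     2 * u + j * (j - 1) \<le> 2 * (2 * s + 2 + x + 3 * c + e + a + 2 * h) + 4 * h * j"

lemma le_floor_sqrt:
  assumes "(4 * t + 3)\<^sup>2 \<le> 16 + 8 * n"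
  shows "int t \<le> \<lfloor>sqrt (1 + real n / 2) - 3 / 4\<rfloor>"
proof -
  have "real ((4 * t + 3)\<^sup>2) \<le> real (16 + 8 * n)" using assms by (simp only: of_nat_le_iff)
  then have "(real t + 3 / 4)\<^sup>2 \<le> 1 + real n / 2" by (simp add: power2_eq_square algebra_simps)
  then have "real t + 3 / 4 \<le> sqrt (1 + real n / 2)" by (rule real_le_rsqrt)
  then show ?thesis by (simp add: le_floor_iff)
qed

lemma diam_gt_if_admissible:
  assumes adm: "admissible l u s x e c a h j" and n: "l \<le> n" "n \<le> u"
  shows "diam (with_proj (fib_run_graph n)) >
    ereal (real_of_int (int n - \<lfloor>sqrt (1 + real n / 2) - 3 / 4\<rfloor>))"
proof -
  \<comment> \<open>The length of the vertices for empty \<open>ys\<close>; \<open>N\<close> is the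
    sum left to \<open>ys\<close>.\<close>
  define base where "base = 2 * s + 2 + x + 3 * c + e + a + 2 * h"
  have e: "e \<le> 1" and L: "s + 3 + x + 3 * c + e < a"
    and ah: "a + e \<le> 2 * h" and ceh: "c + e \<le> h"
    and t: "(4 * (h + 1 - c - e) + 3)\<^sup>2 \<le> 16 + 8 * l"
    and lo: "2 * base + 2 * (a + e) * j + j * (j + 1) \<le> 2 * l"
    and hi: "2 * u + j * (j - 1) \<le> 2 * base + 4 * h * j"
    using adm unfolding admissible_def base_def by blast+
  have "base \<le> n" using lo n by linarith
  then obtain N where N: "n = base + N" using le_Suc_ex by blast
  have "2 * (e + a) * j + j * (j + 1) \<le> 2 * N"
    using lo n N by (simp add: add.commute)
  moreover have "2 * N + j * (j - 1) \<le> 2 * (2 * h) * j"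
    using hi n N by simp
  ultimately obtain ys where ys: "sorted_wrt (<) ((e + a) # ys)" "\<forall>y\<in>set ys. y \<le> 2 * h"
    "sum_list ys = N"
    using ex_sorted_sum_list by blast
  have h: "0 < h" using L ah by linarith
  have "ereal (real n - real h + real c + real e) \<le> diam (with_proj (fib_run_graph n))"
  proof (rule diam_ge_increasing_runs[OF e L h ys(1)])
    show "\<forall>y\<in>set ((e + a) # ys). y \<le> 2 * h" using ys(2) ah by simp
    show "n = s + (s + 3 + x + 3 * c + e) + a + sum_list ys + h + (h - 1)"
      using N ys(3) h unfolding base_def by linarith
  qed
  \<comment> \<open>The summand 1 makes the final inequality strict; \<open>ceh\<close> rules out
    truncation.\<close>
  moreover have "int (h + 1 - c - e) \<le> \<lfloor>sqrt (1 + real n / 2) - 3 / 4\<rfloor>"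
    using t n by (intro le_floor_sqrt) linarith
  then have "real_of_int (int n - \<lfloor>sqrt (1 + real n / 2) - 3 / 4\<rfloor>)
      < real n - real h + real c + real e"
    using ceh by linarith
  ultimately show ?thesis by (meson ereal_less_eq(3) less_ereal.simps(1) order_less_le_trans)
qed

text \<open>For the greatest \<open>t\<close> passing the test in \<open>le_floor_sqrt\<close>, take
  \<open>c\<close> as half of \<open>t - 3\<close>, rounded down, \<open>h\<close> with
  \<open>h + 1 - c - e = t\<close>, the least \<open>a\<close> above \<open>L\<close>, and
  \<open>j = t - 2\<close>. The threshold 629 is the least \<open>n\<close> with
  \<open>P 17\<close>.\<close>

lemma admissible_large:
  assumes "629 \<le> n"
  shows "\<exists>c a h j. admissible n n 0 0 1 c a h j"
proof -
  define P where "P t \<longleftrightarrow> (4 * t + 3)\<^sup>2 \<le> 16 + 8 * n" for t :: nat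
  define t where "t = (GREATEST t. P t)"
  have bd: "k \<le> 16 + 8 * n" if "P k" for k
  proof -
    have "4 * k + 3 \<le> (4 * k + 3)\<^sup>2" by (rule self_le_power) auto
    then show ?thesis using that unfolding P_def by linarith
  qed
  have P17: "P 17" using assms by (simp add: P_def)
  have t17: "17 \<le> t" unfolding t_def using P17 bd by (rule Greatest_le_nat)
  have Pt: "P t" unfolding t_def using P17 bd by (rule GreatestI_nat)
  have nP: "\<not> P (Suc t)"
  proof
    assume "P (Suc t)"
    then have "Suc t \<le> t" unfolding t_def using bd by (rule Greatest_le_nat)
    then show False by simp
  qed
  define c d where "c = (t - 3) div 2" and "d = (t - 3) mod 2"
  have t: "t = 2 * c + 3 + d" and c: "7 \<le> c" and d: "d = 0 \<or> d = 1"
    using t17 unfolding c_def d_def by presburger+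
  \<comment> \<open>Below, \<open>P t\<close> gives the lower bound on \<open>n\<close>, and
    \<open>nP\<close> with \<open>7 \<le> c\<close> the upper one; writing \<open>c = 7 + k\<close>
    builds in the latter condition.\<close>
  obtain k where k: "c = 7 + k" using c le_Suc_ex by blast
  have "admissible n n 0 0 1 c (3 * c + 5) (3 * c + 3 + d) (2 * c + 1 + d)"
    using d
  proof
    assume d: "d = 0"
    show ?thesis using Pt nP unfolding admissible_def P_def t d k
      by (simp add: power2_eq_square algebra_simps)
  next
    assume d: "d = 1"
    show ?thesis using Pt nP unfolding admissible_def P_def t d k
      by (simp add: power2_eq_square algebra_simps)
  qed
  then show ?thesis by blast
qed

theorem theorem4p3:
  fixes n :: nat
  assumes "n \<in> {230..} \<union>
    ({91, 94, 95} \<union> {119..124} \<union> {131, 136} \<union> {152..170} \<union> {172, 178, 181, 184, 185} \<union> {189..223})"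
  shows "diam (with_proj (fib_run_graph n)) >
    ereal (real_of_int (int n - \<lfloor>sqrt (1 + real n / 2) - 3 / 4\<rfloor>))"
proof (rule ccontr)
  assume neg: "\<not> ?thesis"
  \<comment> \<open>Under the negated claim each admissible interval pushes \<open>n\<close> past
    its right end, so adjoining intervals exhaust a range from left to right.\<close>
  have beyond: "u < n" if "l \<le> n" "admissible l u s x e c a h j" for l u s x e c a h j
    using neg diam_gt_if_admissible[OF that(2,1)] by (meson not_le)
  consider "n = 91" | "n = 94" | "n = 95" | "n \<in> {119..124}" | "n = 131" | "n = 136"
    | "n \<in> {152..170}" | "n = 172" | "n = 178" | "n = 181" | "n = 184" | "n = 185"
    | "n \<in> {189..223}" | "n \<in> {230..}"
    using assms unfolding Un_iff insert_iff empty_iff by blast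
  then show False
    \<comment> \<open>The parameters of each interval were found by a computer search.\<close>
  proof cases
    case 1
    then show False using beyond[of 91 91 0 0 1 4 17 10 2] by (simp add: admissible_def)
  next
    case 2
    then show False using beyond[of 94 94 0 0 1 2 11 8 4] by (simp add: admissible_def)
  next
    case 3
    then show False using beyond[of 95 95 0 0 1 3 14 9 3] by (simp add: admissible_def)
  next
    case 4
    then have "120 < n" using beyond[of 119 120 0 0 1 3 14 10 4] by (simp add: admissible_def)
    then have "121 < n" using beyond[of 121 121 0 0 1 1 8 8 7] by (simp add: admissible_def)
    then have "122 < n" using beyond[of 122 122 0 1 1 3 15 10 4] by (simp add: admissible_def)
    then have "123 < n" using beyond[of 123 123 1 0 1 3 15 10 4] by (simp add: admissible_def)
    then show False using 4 beyond[of 124 124 0 0 0 4 16 10 4] by (simp add: admissible_def)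
  next
    case 5
    then show False using beyond[of 131 131 0 0 1 2 11 9 6] by (simp add: admissible_def)
  next
    case 6
    then show False using beyond[of 136 136 0 0 1 3 14 10 5] by (simp add: admissible_def)
  next
    case 7
    then have "159 < n" using beyond[of 152 159 0 0 1 2 11 10 7] by (simp add: admissible_def)
    then have "165 < n" using beyond[of 160 165 0 0 1 3 14 11 6] by (simp add: admissible_def)
    then have "166 < n" using beyond[of 166 166 0 0 1 3 15 11 6] by (simp add: admissible_def)
    then have "167 < n" using beyond[of 167 167 0 0 1 4 18 12 5] by (simp add: admissible_def)
    then have "168 < n" using beyond[of 168 168 0 1 1 4 18 12 5] by (simp add: admissible_def)
    then have "169 < n" using beyond[of 169 169 1 0 1 4 18 12 5] by (simp add: admissible_def)
    then show False using 7 beyond[of 170 170 0 0 0 5 19 12 5] by (simp add: admissible_def)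
  next
    case 8
    then show False using beyond[of 172 172 0 0 1 2 11 10 8] by (simp add: admissible_def)
  next
    case 9
    then show False using beyond[of 178 178 0 0 1 6 23 14 4] by (simp add: admissible_def)
  next
    case 10
    then show False using beyond[of 181 181 0 0 1 3 14 11 7] by (simp add: admissible_def)
  next
    case 11
    then show False using beyond[of 184 184 0 0 1 5 20 13 5] by (simp add: admissible_def)
  next
    case 12
    then show False using beyond[of 185 185 0 0 1 4 17 12 6] by (simp add: admissible_def)
  next
    case 13
    then have "199 < n" using beyond[of 189 199 0 0 1 4 17 13 6] by (simp add: admissible_def)
    then have "204 < n" using beyond[of 200 204 0 0 1 2 11 11 9] by (simp add: admissible_def)
    then have "205 < n" using beyond[of 205 205 0 0 1 2 12 11 9] by (simp add: admissible_def)
    then have "214 < n" using beyond[of 206 214 0 0 1 3 14 12 8] by (simp add: admissible_def)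
    then have "219 < n" using beyond[of 215 219 0 0 1 4 17 13 7] by (simp add: admissible_def)
    then have "220 < n" using beyond[of 220 220 0 0 1 4 18 13 7] by (simp add: admissible_def)
    then have "221 < n" using beyond[of 221 221 0 1 1 4 18 13 7] by (simp add: admissible_def)
    then have "222 < n" using beyond[of 222 222 1 0 1 4 18 13 7] by (simp add: admissible_def)
    then show False using 13 beyond[of 223 223 0 0 0 5 19 13 7] by (simp add: admissible_def)
  next
    case 14
    then have "240 < n" using beyond[of 230 240 0 0 1 2 12 12 10] by (simp add: admissible_def)
    then have "256 < n" using beyond[of 241 256 0 0 1 4 17 14 8] by (simp add: admissible_def)
    then have "267 < n" using beyond[of 257 267 0 0 1 3 14 13 10] by (simp add: admissible_def)
    then have "276 < n" using beyond[of 268 276 0 0 1 4 17 14 9] by (simp add: admissible_def)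
    then have "298 < n" using beyond[of 277 298 0 0 1 5 20 16 8] by (simp add: admissible_def)
    then have "317 < n" using beyond[of 299 317 0 0 1 4 17 15 10] by (simp add: admissible_def)
    then have "326 < n" using beyond[of 318 326 0 0 0 6 22 16 9] by (simp add: admissible_def)
    then have "351 < n" using beyond[of 327 351 0 0 1 3 15 15 12] by (simp add: admissible_def)
    then have "371 < n" using beyond[of 352 371 0 0 0 6 22 17 10] by (simp add: admissible_def)
    then have "391 < n" using beyond[of 372 391 0 0 1 5 20 17 11] by (simp add: admissible_def)
    then have "430 < n" using beyond[of 392 430 0 0 1 4 17 17 13] by (simp add: admissible_def)
    then have "451 < n" using beyond[of 431 451 0 0 1 4 17 17 14] by (simp add: admissible_def)
    then have "498 < n" using beyond[of 452 498 0 0 1 6 23 20 12] by (simp add: admissible_def)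
    then have "558 < n" using beyond[of 499 558 0 0 1 4 17 19 16] by (simp add: admissible_def)
    then have "598 < n" using beyond[of 559 598 0 0 1 5 20 20 16] by (simp add: admissible_def)
    then have "628 < n" using beyond[of 599 628 0 0 1 3 14 19 20] by (simp add: admissible_def)
    \<comment> \<open>From 629 on, the parameters with \<open>l = u = n\<close> give
      \<open>n < n\<close>.\<close>
    then show False using admissible_large[of n] beyond by force
  qed
qed

end
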